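(* Let $0<q<1$ and let $\xi,\eta$ be non-negative real numbers that are sufficiently small depending only on $q$. Let $\boldsymbol{k},\boldsymbol{l}$ be indices (possibly non-admissible or empty). If $\boldsymbol{l}$ is non-empty, then \[ Z(\boldsymbol{k}_{\to};\boldsymbol{l})=Z(\boldsymbol{k};\boldsymbol{l}_{\uparrow})+\xi\eta\cdot Z(\boldsymbol{k}_{\to\uparrow};\boldsymbol{l}_{\uparrow}). \] If $\boldsymbol{k}$ is non-empty, then \[ Z(\boldsymbol{k}_{\uparrow};\boldsymbol{l})=Z(\boldsymbol{k};\boldsymbol{l}_{\to})-\xi\eta\cdot Z(\boldsymbol{k}_{\uparrow};\boldsymbol{l}_{\to\uparrow}). \]
   Context: An index is a (possibly empty) tuple of positive integers $(k_1,\dots,k_r)$; the empty index $\varnothing$ has depth $0$. For $m\ge1$, $[m]=\frac{1-q^m}{1-q}$; for $a\ge0$ and real $\delta$, $[a;\delta]=\prod_{i=1}^a([i]-q^i\delta)$, $[a]!=[a;0]$. Connector: $c(m,n)=\frac{q^{mn}[m;\xi][m;\eta][n;\xi][n;\eta]}{[m]![n]![m+n;\xi+\eta+(1-q)\xi\eta]}$. For indices $\boldsymbol{k}=(k_1,\dots,k_r)$, $\boldsymbol{l}=(l_1,\dots,l_s)$, the connected sum is the (possibly divergent) series of positive terms \[ Z(\boldsymbol{k};\boldsymbol{l})=\sum_{\substack{0=m_0<m_1<\cdots<m_r\\0=n_0<n_1<\cdots<n_s}}\prod_{i=1}^r\frac{q^{(k_i-1)m_i}}{([m_i]-q^{m_i}\xi)([m_i]-q^{m_i}\eta)[m_i]^{k_i-2}}\cdot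 c(m_r,n_s)\cdot\prod_{j=1}^s\frac{q^{(l_j-1)n_j}}{([n_j]-q^{n_j}\xi)([n_j]-q^{n_j}\eta)[n_j]^{l_j-2}}, \] empty products being $1$. Arrow notation: for $\boldsymbol{k}=(k_1,\dots,k_r)$, $\boldsymbol{k}_{\to}=(k_1,\dots,k_r,1)$ (with $\varnothing_{\to}=(1)$), $\boldsymbol{k}_{\uparrow}=(k_1,\dots,k_{r-1},k_r+1)$ for $\boldsymbol{k}\ne\varnothing$, and compositions are applied left to right, e.g. $\boldsymbol{k}_{\to\uparrow}=(\boldsymbol{k}_{\to})_{\uparrow}=(k_1,\dots,k_r,2)$. *)

theory Defs
  imports "HOL-Analysis.Analysis"
begin

definition is_index :: "nat list \<Rightarrow> bool" where
  "is_index k \<longleftrightarrow> (\<forall>a\<in>set k. 0 < a)"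

definition arrow_right :: "nat list \<Rightarrow> nat list" where
  "arrow_right k = k @ [1]"

text \<open>Only meaningful for a non-empty index.\<close>
definition arrow_up :: "nat list \<Rightarrow> nat list" where
  "arrow_up k = butlast k @ [last k + 1]"

definition q_num :: "real \<Rightarrow> nat \<Rightarrow> real" where
  "q_num q m = (1 - q ^ m) / (1 - q)"

text \<open>\<open>q_shift q \<delta> a\<close> is \<open>[a; \<delta>]\<close>; in particular \<open>q_shift q 0 a\<close> is \<open>[a]!\<close>.\<close>
definition q_shift :: "real \<Rightarrow> real \<Rightarrow> nat \<Rightarrow> real" where
  "q_shift q \<delta> a = (\<Prod>i=1..a. q_num q i - q ^ i * \<delta>)"

definition q_fact :: "real \<Rightarrow> nat \<Rightarrow> real" where
  "q_fact q a = q_shift q 0 a"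

definition connector :: "real \<Rightarrow> real \<Rightarrow> real \<Rightarrow> nat \<Rightarrow> nat \<Rightarrow> real" where
  "connector q \<xi> \<eta> m n =
     q ^ (m * n) * q_shift q \<xi> m * q_shift q \<eta> m * q_shift q \<xi> n * q_shift q \<eta> n
     / (q_fact q m * q_fact q n * q_shift q (\<xi> + \<eta> + (1 - q) * \<xi> * \<eta>) (m + n))"

text \<open>The entries of an index are positive, so \<open>k - 1\<close> does not truncate; the exponent
  \<open>k - 2\<close> may be \<open>-1\<close> and is therefore taken in the integers.\<close>
definition Z_factor :: "real \<Rightarrow> real \<Rightarrow> real \<Rightarrow> nat \<Rightarrow> nat \<Rightarrow> real" where
  "Z_factor q \<xi> \<eta> k m =
     q ^ ((k - 1) * m)
     / ((q_num q m - q ^ m * \<xi>) * (q_num q m - q ^ m * \<eta>) * q_num q m powi (int k - 2))"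

text \<open>Tuples \<open>0 = m\<^sub>0 < m\<^sub>1 < \<dots> < m\<^sub>r\<close>, stored without \<open>m\<^sub>0\<close>: the entry \<open>m\<^sub>i\<close> is \<open>ms ! (i - 1)\<close>
  for \<open>i \<ge> 1\<close>, and \<open>m\<^sub>r\<close> is \<open>last (0 # ms)\<close>, also for \<open>r = 0\<close>.\<close>
definition incr_tuples :: "nat \<Rightarrow> nat list set" where
  "incr_tuples r = {ms. length ms = r \<and> sorted_wrt (<) (0 # ms)}"

text \<open>The sum is taken in the extended reals, so that a divergent series of positive terms has
  the value \<open>\<infinity>\<close>.\<close>
definition Z_sum :: "real \<Rightarrow> real \<Rightarrow> real \<Rightarrow> nat list \<Rightarrow> nat list \<Rightarrow> ereal" where
  "Z_sum q \<xi> \<eta> k l =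
     (\<Sum>\<^sub>\<infinity>(ms, ns) \<in> incr_tuples (length k) \<times> incr_tuples (length l).
        ereal ((\<Prod>i<length k. Z_factor q \<xi> \<eta> (k ! i) (ms ! i))
               * connector q \<xi> \<eta> (last (0 # ms)) (last (0 # ns))
               * (\<Prod>j<length l. Z_factor q \<xi> \<eta> (l ! j) (ns ! j))))"

end

theory Submission
  imports Defs
begin

text \<open>
  The quotient \<open>c(a-1,n) / c(a,n)\<close> is explicit, and it turns the difference
  \<open>q\<^sup>n/[n] (c(a-1,n) - c(a,n))\<close> into a combination of the two terms that the entries \<open>1\<close> and \<open>2\<close>
  contribute at \<open>m\<^sub>r\<^sub>+\<^sub>1 = a\<close>. Since \<open>c(a,n) \<rightarrow> 0\<close> for \<open>n \<ge> 1\<close>, summing over \<open>a > m\<^sub>r\<close> telescopes and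
  gives the first relation. The second one is the first with the two indices exchanged; moving
  a term to the other side is legitimate because \<open>c(m,n)\<close> is bounded and a last entry \<open>\<ge> 2\<close>
  contributes a factor \<open>q\<^sup>m\<close>, so that the subtracted series is dominated by a geometric one.
\<close>

section \<open>Countable sums as integrals, and telescoping\<close>

text \<open>Enumerating an infinite \<open>A\<close> by \<open>from_nat_into\<close> turns both
  sides into the same series over the naturals; in \<open>ennreal\<close> every family is summable.
  The integral form gives additivity and Tonelli without any convergence hypothesis.\<close>

lemma infsum_ennreal_eq_nn_integral:
  fixes f :: "'a \<Rightarrow> ennreal"
  assumes "countable A"
  shows "infsum f A = (\<integral>\<^sup>+x. f x \<partial>count_space A)"
proof (cases "finite A")
  case True
  then show ?thesis
    by (simp add: nn_integral_count_space_finite)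
next
  case False
  let ?e = "from_nat_into A"
  have bij: "bij_betw ?e UNIV A"
    using assms False by (rule bij_betw_from_nat_into)
  have "((\<lambda>n. f (?e n)) has_sum infsum (\<lambda>n. f (?e n)) UNIV) UNIV"
    by (intro has_sum_infsum nonneg_summable_on_complete) simp
  then have "infsum (\<lambda>n. f (?e n)) UNIV = (\<Sum>n. f (?e n))"
    by (intro sums_unique has_sum_imp_sums)
  then show ?thesis
    using infsum_reindex_bij_betw[OF bij, of f] nn_integral_bij_count_space[OF bij, of f]
    by (simp add: nn_integral_count_space_nat)
qed

text \<open>The embedding \<open>enn2ereal\<close> is additive and continuous, so it commutes with
  the sum. Non-negativity matters because \<open>ennreal\<close> sends negative reals to 0.\<close>

lemma infsum_ereal_eq_nn_integral:
  fixes f :: "'a \<Rightarrow> real"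
  assumes "countable A" and "\<And>x. x \<in> A \<Longrightarrow> 0 \<le> f x"
  shows "(\<Sum>\<^sub>\<infinity>x\<in>A. ereal (f x)) = enn2ereal (\<integral>\<^sup>+x. ennreal (f x) \<partial>count_space A)"
proof -
  have "(\<Sum>\<^sub>\<infinity>x\<in>A. ereal (f x)) = infsum (enn2ereal \<circ> (\<lambda>x. ennreal (f x))) A"
    using assms(2) by (intro infsum_cong) (simp add: enn2ereal_ennreal)
  also have "\<dots> = enn2ereal (infsum (\<lambda>x. ennreal (f x)) A)"
    by (simp add: infsum_comm_additive_general continuous_at_enn2ereal nonneg_summable_on_complete)
  finally show ?thesis
    using infsum_ennreal_eq_nn_integral[OF assms(1)] by simp
qed

text \<open>Tonelli for fibres that depend on the first coordinate: indicators reduce it to the case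
  where both coordinates range over \<open>UNIV\<close>.\<close>

lemma nn_integral_count_space_Sigma:
  "(\<integral>\<^sup>+z. f z \<partial>count_space (Sigma A B)) =
   (\<integral>\<^sup>+x. \<integral>\<^sup>+y. f (x, y) \<partial>count_space (B x) \<partial>count_space A)"
proof -
  have "(\<integral>\<^sup>+z. f z \<partial>count_space (Sigma A B)) =
      (\<integral>\<^sup>+z. f z * indicator (Sigma A B) z \<partial>count_space UNIV)"
    by (simp add: nn_integral_count_space_indicator)
  also have "\<dots> = (\<integral>\<^sup>+x. \<integral>\<^sup>+y. f (x, y) * indicator (Sigma A B) (x, y)
      \<partial>count_space UNIV \<partial>count_space UNIV)"
    by (rule nn_integral_fst_count_space[symmetric])
  also have "\<dots> = (\<integral>\<^sup>+x. (\<integral>\<^sup>+y. f (x, y) \<partial>count_space (B x)) * indicator A x \<partial>count_space UNIV)"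
    by (intro nn_integral_cong)
       (auto simp: nn_integral_count_space_indicator split: split_indicator intro!: nn_integral_cong)
  finally show ?thesis
    by (simp add: nn_integral_count_space_indicator)
qed

text \<open>Appending an entry is a bijection onto the longer tuples. This isolates the last entry,
  the variable over which the series telescopes; \<open>last (0 # ms)\<close> supplies the bound 0
  when \<open>r = 0\<close>.\<close>

lemma nn_integral_incr_tuples_Suc:
  "(\<integral>\<^sup>+ms. f ms \<partial>count_space (incr_tuples (Suc r))) =
   (\<integral>\<^sup>+ms. \<integral>\<^sup>+a. f (ms @ [a]) \<partial>count_space {last (0 # ms)<..} \<partial>count_space (incr_tuples r))"
proof -
  have lt: "x < a" if "sorted_wrt (<) (0 # ms)" "last (0 # ms) < a" "x \<in> set (0 # ms)"
    for x a :: nat and ms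
  proof -
    have "x \<le> last (0 # ms)"
      using that sorted_wrt_append[of "(<)" "butlast (0 # ms)" "[last (0 # ms)]"]
      by (metis append_butlast_last_id list.distinct(1) list.set_intros(1) nat_less_le
          order_refl rotate1.simps(2) set_ConsD set_rotate1)
    with that show ?thesis by simp
  qed
  have "bij_betw (\<lambda>(ms, a). ms @ [a]) (SIGMA ms : incr_tuples r. {last (0 # ms)<..})
      (incr_tuples (Suc r))"
  proof (rule bij_betwI')
    show "(case x of (ms, a) \<Rightarrow> ms @ [a]) = (case y of (ms, a) \<Rightarrow> ms @ [a]) \<longleftrightarrow> x = y"
      for x y :: "nat list \<times> nat"
      by (cases x; cases y) auto
  next
    fix x assume "x \<in> (SIGMA ms : incr_tuples r. {last (0 # ms)<..})"
    then show "(case x of (ms, a) \<Rightarrow> ms @ [a]) \<in> incr_tuples (Suc r)"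
      using lt by (cases x) (auto simp: incr_tuples_def sorted_wrt_append)
  next
    fix ns assume ns: "ns \<in> incr_tuples (Suc r)"
    then have "ns \<noteq> []" by (auto simp: incr_tuples_def)
    then obtain ms a where "ns = ms @ [a]" by (metis append_butlast_last_id)
    with ns have "(ms, a) \<in> (SIGMA ms : incr_tuples r. {last (0 # ms)<..})"
      by (auto simp: incr_tuples_def sorted_wrt_append)
    with \<open>ns = ms @ [a]\<close>
    show "\<exists>x\<in>(SIGMA ms : incr_tuples r. {last (0 # ms)<..}). ns = (case x of (ms, a) \<Rightarrow> ms @ [a])"
      by force
  qed
  from nn_integral_bij_count_space[OF this, of f] show ?thesis
    by (simp add: nn_integral_count_space_Sigma split_def)
qed

text \<open>The partial sums satisfy the identity with a boundary term \<open>D\<close> on each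
  side. Since nothing is subtracted, the limit can be taken in \<open>ennreal\<close> even if both
  integrals are infinite.\<close>

lemma nn_integral_telescope:
  fixes U V D :: "nat \<Rightarrow> real"
  assumes U: "\<And>a. m < a \<Longrightarrow> 0 \<le> U a" and V: "\<And>a. m < a \<Longrightarrow> 0 \<le> V a"
    and D: "\<And>a. m \<le> a \<Longrightarrow> 0 \<le> D a" "D \<longlonglongrightarrow> 0"
    and step: "\<And>a. m \<le> a \<Longrightarrow> U (Suc a) + D (Suc a) = V (Suc a) + D a"
  shows "(\<integral>\<^sup>+a. ennreal (U a) \<partial>count_space {m<..}) =
    ennreal (D m) + (\<integral>\<^sup>+a. ennreal (V a) \<partial>count_space {m<..})"
proof -
  have bij: "bij_betw (\<lambda>i. Suc (m + i)) UNIV {m<..}"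
    by (rule bij_betw_byWitness[where f' = "\<lambda>a. a - Suc m"]) auto
  have conv: "(\<lambda>N. \<Sum>i<N. ennreal (f (Suc (m + i))))
      \<longlonglongrightarrow> (\<integral>\<^sup>+a. ennreal (f a) \<partial>count_space {m<..})" for f
    unfolding nn_integral_bij_count_space[OF bij, symmetric] nn_integral_count_space_nat
    by (rule summable_LIMSEQ) simp
  have "(\<Sum>i<N. U (Suc (m + i))) + D (m + N) = D m + (\<Sum>i<N. V (Suc (m + i)))" for N
  proof (induction N)
    case (Suc N)
    with step[of "m + N"] show ?case by simp
  qed simp
  then have "ennreal ((\<Sum>i<N. U (Suc (m + i))) + D (m + N)) =
      ennreal (D m + (\<Sum>i<N. V (Suc (m + i))))" for N
    by simp
  then have partial: "(\<Sum>i<N. ennreal (U (Suc (m + i)))) + ennreal (D (m + N)) =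
      ennreal (D m) + (\<Sum>i<N. ennreal (V (Suc (m + i))))" for N
    using U V D(1) by (simp add: sum_nonneg)
  have "(\<lambda>N. D (m + N)) \<longlonglongrightarrow> 0"
    using LIMSEQ_ignore_initial_segment[OF D(2), of m] by (simp add: add.commute)
  then have "(\<lambda>N. ennreal (D (m + N))) \<longlonglongrightarrow> 0"
    using tendsto_ennrealI by fastforce
  then have "(\<lambda>N. (\<Sum>i<N. ennreal (U (Suc (m + i)))) + ennreal (D (m + N)))
      \<longlonglongrightarrow> (\<integral>\<^sup>+a. ennreal (U a) \<partial>count_space {m<..}) + 0"
    by (intro tendsto_add conv)
  moreover have "(\<lambda>N. ennreal (D m) + (\<Sum>i<N. ennreal (V (Suc (m + i)))))
      \<longlonglongrightarrow> ennreal (D m) + (\<integral>\<^sup>+a. ennreal (V a) \<partial>count_space {m<..})"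
    by (intro tendsto_add conv tendsto_const)
  ultimately show ?thesis
    unfolding partial using LIMSEQ_unique by fastforce
qed

section \<open>Symmetry of the connected sum, and entries of increasing tuples\<close>

lemma connector_commute: "connector q \<xi> \<eta> m n = connector q \<xi> \<eta> n m"
  by (simp add: connector_def mult_ac add_ac)

lemma Z_sum_commute: "Z_sum q \<xi> \<eta> k l = Z_sum q \<xi> \<eta> l k"
proof -
  have bij: "bij_betw prod.swap (incr_tuples (length l) \<times> incr_tuples (length k))
      (incr_tuples (length k) \<times> incr_tuples (length l))"
    by (rule bij_betw_byWitness[where f' = prod.swap]) auto
  show ?thesis
    unfolding Z_sum_def infsum_reindex_bij_betw[OF bij, symmetric]
    by (intro infsum_cong) (auto simp: mult_ac connector_commute)
qed

lemma arrow_up_arrow_right: "arrow_up (arrow_right k) = k @ [2]"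
  by (simp add: arrow_up_def arrow_right_def)

lemma incr_tuples_nth_pos: "ms \<in> incr_tuples r \<Longrightarrow> i < r \<Longrightarrow> 0 < ms ! i"
  by (auto simp: incr_tuples_def)

lemma last_incr_tuples_pos:
  assumes "ms \<in> incr_tuples r" "0 < r"
  shows "0 < last (0 # ms)"
  using assms incr_tuples_nth_pos[of ms r "r - 1"]
  by (auto simp: incr_tuples_def last_conv_nth)

text \<open>These bounds keep every factor \<open>[i] - q^i * d\<close> with
  \<open>i \<ge> 1\<close> positive for \<open>d\<close> equal to \<xi>, \<eta> or the parameter
  \<delta> of the connector's denominator, because \<open>[i] \<ge> 1\<close> and
  \<open>q^i \<le> 1\<close>.\<close>

locale connected_sum =
  fixes q \<xi> \<eta> :: real
  assumes q: "0 < q" "q < 1"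
    and \<xi>: "0 \<le> \<xi>" "\<xi> < 1"
    and \<eta>: "0 \<le> \<eta>" "\<eta> < 1"
    and \<delta>_less_1: "\<xi> + \<eta> + (1 - q) * \<xi> * \<eta> < 1"
begin

abbreviation "\<delta> \<equiv> \<xi> + \<eta> + (1 - q) * \<xi> * \<eta>"
abbreviation "num \<equiv> q_num q"
abbreviation "shift \<equiv> q_shift q"
abbreviation "conn \<equiv> connector q \<xi> \<eta>"
abbreviation "fac \<equiv> Z_factor q \<xi> \<eta>"

section \<open>Estimates for q-integers and shifted q-factorials\<close>

lemma \<delta>_nonneg: "0 \<le> \<delta>"
  using q \<xi> \<eta> by simp

lemma num_Suc: "num (Suc m) = num m + q ^ m"
  using q by (simp add: q_num_def field_simps)

lemma num_nonneg: "0 \<le> num m"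
  using q by (simp add: q_num_def power_le_one)

lemma num_le: "num m \<le> 1 / (1 - q)"
  using q by (simp add: q_num_def divide_right_mono)

lemma num_mono: "m \<le> n \<Longrightarrow> num m \<le> num n"
  using q by (simp add: q_num_def divide_right_mono power_decreasing)

lemma num_ge_1: "0 < m \<Longrightarrow> 1 \<le> num m"
  using num_mono[of 1 m] q by (simp add: q_num_def)

lemma num_diff_ge:
  assumes "0 \<le> d" "0 < m"
  shows "1 - d \<le> num m - q ^ m * d"
proof -
  have "q ^ m * d \<le> 1 * d"
    using q assms by (intro mult_right_mono power_le_one) auto
  with num_ge_1[OF assms(2)] show ?thesis by simp
qed

lemma num_diff_pos: "0 \<le> d \<Longrightarrow> d < 1 \<Longrightarrow> 0 < m \<Longrightarrow> 0 < num m - q ^ m * d"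
  using num_diff_ge[of d m] by simp

lemma shift_0: "shift d 0 = 1"
  by (simp add: q_shift_def)

lemma shift_Suc: "shift d (Suc m) = shift d m * (num (Suc m) - q ^ Suc m * d)"
  by (simp add: q_shift_def)

lemma shift_pos: "0 \<le> d \<Longrightarrow> d < 1 \<Longrightarrow> 0 < shift d m"
  unfolding q_shift_def by (intro prod_pos ballI num_diff_pos) auto

lemma shift_le_fact: "0 \<le> d \<Longrightarrow> d < 1 \<Longrightarrow> shift d m \<le> shift 0 m"
  unfolding q_shift_def
  using q by (intro prod_mono conjI less_imp_le[OF num_diff_pos]) auto

text \<open>The factors are compared one by one: \<open>[i] \<le> [m + i]\<close>.\<close>

lemma fact_add_ge: "shift 0 m * shift 0 n \<le> shift 0 (m + n)"
proof (induction n)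
  case (Suc n)
  have "shift 0 m * shift 0 n * num (Suc n) \<le> shift 0 (m + n) * num (Suc (m + n))"
    using Suc num_mono[of "Suc n" "Suc (m + n)"] num_nonneg shift_pos[of 0]
    by (intro mult_mono) (auto simp: less_imp_le)
  then show ?case by (simp add: shift_Suc mult_ac)
qed (simp add: shift_0)

text \<open>The factors are compared with an offset of one. The first factor of
  \<open>[m+1; d]\<close> is at least \<open>1 - d\<close>, and factor \<open>i + 1\<close> is at
  least \<open>[i]\<close>, because \<open>[i+1] = [i] + q^i\<close> and
  \<open>q^(i+1) * d \<le> q^i\<close>.\<close>

lemma shift_Suc_ge:
  assumes d: "0 \<le> d" "d < 1"
  shows "(1 - d) * shift 0 m \<le> shift d (Suc m)"
proof (induction m)
  case 0
  then show ?case
    using num_diff_ge[of d 1] d by (simp add: shift_0 shift_Suc)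
next
  case (Suc m)
  have "q ^ Suc (Suc m) * d \<le> q ^ Suc m * 1"
    using q d by (intro mult_mono power_decreasing) auto
  then have "num (Suc m) \<le> num (Suc (Suc m)) - q ^ Suc (Suc m) * d"
    by (subst num_Suc[of "Suc m"]) simp
  then have "(1 - d) * shift 0 m * num (Suc m) \<le>
      shift d (Suc m) * (num (Suc (Suc m)) - q ^ Suc (Suc m) * d)"
    using Suc num_nonneg shift_pos[OF d, of "Suc m"] by (intro mult_mono) auto
  then show ?case by (simp add: shift_Suc mult_ac)
qed

text \<open>The offset in \<open>shift_Suc_ge\<close> leaves the last factor \<open>[m]\<close> of
  \<open>[m]!\<close> unmatched; it is at most \<open>1 / (1 - q)\<close>, which accounts for the
  constant \<open>1 - q\<close>.\<close>

lemma shift_ge_fact: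
  assumes d: "0 \<le> d" "d < 1"
  shows "(1 - d) * (1 - q) * shift 0 m \<le> shift d m"
proof (cases m)
  case 0
  have "(1 - d) * (1 - q) \<le> 1 * 1" using q d by (intro mult_mono) auto
  with 0 show ?thesis by (simp add: shift_0)
next
  case (Suc n)
  have "(1 - q) * num (Suc n) \<le> 1"
    using num_le[of "Suc n"] q by (simp add: field_simps)
  then have "(1 - d) * shift 0 n * ((1 - q) * num (Suc n)) \<le> (1 - d) * shift 0 n * 1"
    using d shift_pos[of 0 n] by (intro mult_left_mono) auto
  also have "\<dots> \<le> shift d (Suc n)"
    using shift_Suc_ge[OF d, of n] by simp
  finally show ?thesis by (simp add: Suc shift_Suc mult_ac)
qed

section \<open>Size and decay of the connector\<close>

lemma conn_nonneg: "0 \<le> conn m n"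
  unfolding connector_def q_fact_def
  using q shift_pos[OF \<xi>] shift_pos[OF \<eta>] shift_pos[OF \<delta>_nonneg \<delta>_less_1] shift_pos[of 0]
  by (intro divide_nonneg_nonneg mult_nonneg_nonneg) (auto intro: less_imp_le)

text \<open>Up to \<open>q^(m * n)\<close>, the numerator is at most the square of
  \<open>[m]! [n]!\<close>, while \<open>[m+n; \<delta>]\<close> is at least
  \<open>(1 - \<delta>) * (1 - q)\<close> times \<open>[m]! [n]!\<close>, so the factorials cancel.
  Keeping \<open>q^(m * n)\<close> gives geometric decay in \<open>m\<close> for each fixed
  \<open>n \<ge> 1\<close>.\<close>

lemma conn_le: "conn m n \<le> q ^ (m * n) / ((1 - \<delta>) * (1 - q))"
proof -
  define K where "K = (1 - \<delta>) * (1 - q)"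
  have K: "0 < K" using q \<delta>_less_1 by (simp add: K_def)
  note pos = shift_pos[OF \<xi>] shift_pos[OF \<eta>] shift_pos[OF \<delta>_nonneg \<delta>_less_1] shift_pos[of 0]
  have f: "0 < shift 0 m" "0 < shift 0 n" using pos by auto
  have "shift \<xi> m * shift \<eta> m * shift \<xi> n * shift \<eta> n \<le>
      shift 0 m * shift 0 m * shift 0 n * shift 0 n"
    using shift_le_fact[OF \<xi>] shift_le_fact[OF \<eta>] pos
    by (intro mult_mono) (auto intro: less_imp_le)
  moreover have "K * (shift 0 m * shift 0 n) \<le> shift \<delta> (m + n)"
    using mult_left_mono[OF fact_add_ge[of m n], of K] K
      shift_ge_fact[OF \<delta>_nonneg \<delta>_less_1, of "m + n"] unfolding K_def by linarith
  ultimately have "shift \<xi> m * shift \<eta> m * shift \<xi> n * shift \<eta> n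
      / (shift 0 m * shift 0 n * shift \<delta> (m + n)) \<le>
      (shift 0 m * shift 0 m * shift 0 n * shift 0 n)
      / (shift 0 m * shift 0 n * (K * (shift 0 m * shift 0 n)))"
    using f K by (intro frac_le mult_left_mono) (auto intro: less_imp_le)
  also have "\<dots> = 1 / K"
    using f K by (simp add: field_simps)
  finally have "q ^ (m * n) * (shift \<xi> m * shift \<eta> m * shift \<xi> n * shift \<eta> n
      / (shift 0 m * shift 0 n * shift \<delta> (m + n))) \<le> q ^ (m * n) * (1 / K)"
    using q by (intro mult_left_mono) auto
  then show ?thesis
    by (simp add: connector_def q_fact_def K_def mult.assoc)
qed

lemma conn_tendsto_0:
  assumes "0 < n"
  shows "(\<lambda>a. conn a n) \<longlonglongrightarrow> 0"
proof (rule tendsto_sandwich[of "\<lambda>_. 0" _ _ "\<lambda>a. (q ^ n) ^ a / ((1 - \<delta>) * (1 - q))"])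
  have "q ^ n < 1" using q assms by (simp add: power_less_one_iff)
  then show "(\<lambda>a. (q ^ n) ^ a / ((1 - \<delta>) * (1 - q))) \<longlonglongrightarrow> 0"
    using q by (intro tendsto_divide_zero LIMSEQ_power_zero) simp
  show "\<forall>\<^sub>F a in sequentially. conn a n \<le> (q ^ n) ^ a / ((1 - \<delta>) * (1 - q))"
    using conn_le[of _ n] by (simp add: power_mult[symmetric] mult.commute)
qed (simp_all add: conn_nonneg)

section \<open>The factors attached to single entries\<close>

lemma fac_nonneg: "0 < m \<Longrightarrow> 0 \<le> fac k m"
  unfolding Z_factor_def
  using q num_diff_pos[OF \<xi>, of m] num_diff_pos[OF \<eta>, of m] num_nonneg[of m]
  by (intro divide_nonneg_nonneg mult_nonneg_nonneg) auto

lemma fac_Suc: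
  assumes "0 < k" "0 < m"
  shows "fac (Suc k) m = fac k m * (q ^ m / num m)"
proof -
  have "num m \<noteq> 0" using num_ge_1[OF assms(2)] by simp
  then have "num m powi (int (Suc k) - 2) = num m powi (int k - 2) * num m"
    using power_int_add_1[of "num m" "int k - 2"] by (simp add: algebra_simps)
  \<comment> \<open>Here \<open>0 < k\<close> is essential: for \<open>k = 0\<close> the
    natural-number subtraction would truncate and the exponent would not grow by
    \<open>m\<close>.\<close>
  moreover have "q ^ ((Suc k - 1) * m) = q ^ ((k - 1) * m) * q ^ m"
    using assms(1) by (cases k) (simp_all add: power_add)
  ultimately show ?thesis
    unfolding Z_factor_def by simp
qed

text \<open>The entry \<open>k = 1\<close> is the delicate one: there \<open>[m]^(k-2)\<close> is
  \<open>1 / [m]\<close>, which is still at least \<open>1 - q\<close>. For \<open>k \<ge> 2\<close>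
  the power is at least 1.\<close>

lemma fac_le:
  assumes "0 < k" "0 < m"
  shows "fac k m \<le> 1 / ((1 - \<xi>) * (1 - \<eta>) * (1 - q))"
proof -
  have n1: "1 \<le> num m" using num_ge_1[OF assms(2)] .
  have "1 - q \<le> num m powi (int k - 2)"
  proof (cases "k = 1")
    case True
    then show ?thesis
      using num_le[of m] n1 q by (simp add: power_int_minus field_simps)
  next
    case False
    with assms have "int k - 2 = int (k - 2)" by simp
    then have "num m powi (int k - 2) = num m ^ (k - 2)" by (simp only: power_int_of_nat)
    then show ?thesis using n1 q by (smt (verit) one_le_power)
  qed
  then have "(1 - \<xi>) * (1 - \<eta>) * (1 - q) \<le>
      (num m - q ^ m * \<xi>) * (num m - q ^ m * \<eta>) * num m powi (int k - 2)"
    using \<xi> \<eta> q num_diff_ge[OF \<xi>(1) assms(2)] num_diff_ge[OF \<eta>(1) assms(2)]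
    by (intro mult_mono) auto
  then show ?thesis
    unfolding Z_factor_def using q \<xi> \<eta> by (intro frac_le power_le_one) auto
qed

section \<open>The transport identity for the connector\<close>

text \<open>After division by \<open>conn a n\<close>, everything reduces to the polynomial identity
  \<open>key\<close>. Terms are placed so that both sides are sums of non-negative quantities, as
  \<open>nn_integral_telescope\<close> requires.\<close>

lemma conn_step:
  assumes "0 < n"
  shows "fac 1 (Suc a) * conn (Suc a) n + q ^ n / num n * conn (Suc a) n =
    \<xi> * \<eta> * (q ^ n / num n) * fac 2 (Suc a) * conn (Suc a) n + q ^ n / num n * conn a n"
proof -
  define y where "y = q ^ n"
  define A B where "A = num (Suc a) - q ^ Suc a * \<xi>" and "B = num (Suc a) - q ^ Suc a * \<eta>"
  define M where "M = num (Suc a + n) - q ^ (Suc a + n) * \<delta>"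
  have A: "A \<noteq> 0" and B: "B \<noteq> 0" and M: "M \<noteq> 0"
    using num_diff_pos[OF \<xi>] num_diff_pos[OF \<eta>] num_diff_pos[OF \<delta>_nonneg \<delta>_less_1]
    unfolding A_def B_def M_def by (metis less_irrefl zero_less_Suc add_Suc)+
  have Na: "num (Suc a) \<noteq> 0" and Nn: "num n \<noteq> 0"
    using num_ge_1[of "Suc a"] num_ge_1[OF assms] by auto
  have c: "conn (Suc a) n = conn a n * (y * A * B / (num (Suc a) * M))"
    by (simp add: connector_def q_fact_def shift_Suc A_def B_def M_def y_def power_add mult_ac)
  have f: "fac 1 (Suc a) = num (Suc a) / (A * B)" "fac 2 (Suc a) = q ^ Suc a / (A * B)"
    by (simp_all add: Z_factor_def A_def B_def power_int_minus field_simps)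
  have "(1 - q) * num (Suc a) = 1 - q ^ Suc a"
    using q by (simp add: q_num_def)
  moreover have "M = num n + y * num (Suc a) - q ^ Suc a * y * \<delta>"
    using q by (simp add: M_def q_num_def y_def power_add field_simps)
  \<comment> \<open>Here \<open>u\<close>, \<open>p\<close> and \<open>v\<close> stand for
    \<open>[a+1]\<close>, \<open>q^(a+1)\<close> and \<open>[n]\<close>. Expanding and cancelling
    leaves \<open>(1 - q) * u * \<xi> * \<eta> = \<xi> * \<eta> * (1 - p)\<close>; this is what the
    summand \<open>(1 - q) * \<xi> * \<eta>\<close> of \<delta> is for.\<close>
  moreover have "v * u + y * (u - p * \<xi>) * (u - p * \<eta>) = \<xi> * \<eta> * y * p + u * M"
    if "(1 - q) * u = 1 - p" "M = v + y * u - p * y * \<delta>" for u v p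
    using that by algebra
  ultimately have key: "num n * num (Suc a) + y * A * B =
      \<xi> * \<eta> * y * q ^ Suc a + num (Suc a) * M"
    unfolding A_def B_def by blast
  have "fac 1 (Suc a) * conn (Suc a) n + y / num n * conn (Suc a) n =
      conn a n * y / (num n * num (Suc a) * M) * (num n * num (Suc a) + y * A * B)"
    unfolding c f using A B M Na Nn by (simp add: divide_simps) (simp add: algebra_simps)
  also have "\<dots> = \<xi> * \<eta> * (y / num n) * fac 2 (Suc a) * conn (Suc a) n + y / num n * conn a n"
    unfolding c f key using A B M Na Nn by (simp add: divide_simps) (simp add: algebra_simps)
  finally show ?thesis
    by (simp add: y_def)
qed

section \<open>The connected sum as an iterated integral, and its transport\<close>

definition weight :: "nat list \<Rightarrow> nat list \<Rightarrow> real" where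
  "weight k ms = (\<Prod>i<length k. fac (k ! i) (ms ! i))"

text \<open>The tuple \<open>ms\<close> is integrated innermost, so that splitting off its last
  entry exposes the telescoping variable while \<open>ns\<close> stays fixed.\<close>

definition Z_nn :: "nat list \<Rightarrow> nat list \<Rightarrow> ennreal" where
  "Z_nn k l = (\<integral>\<^sup>+ns. \<integral>\<^sup>+ms. ennreal (weight k ms * conn (last (0 # ms)) (last (0 # ns)) * weight l ns)
     \<partial>count_space (incr_tuples (length k)) \<partial>count_space (incr_tuples (length l)))"

lemma weight_nonneg: "ms \<in> incr_tuples (length k) \<Longrightarrow> 0 \<le> weight k ms"
  unfolding weight_def by (intro prod_nonneg ballI fac_nonneg) (auto intro: incr_tuples_nth_pos)

lemma weight_le:
  assumes "is_index k" "ms \<in> incr_tuples (length k)"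
  shows "weight k ms \<le> (1 / ((1 - \<xi>) * (1 - \<eta>) * (1 - q))) ^ length k"
proof -
  have "weight k ms \<le> (\<Prod>i<length k. 1 / ((1 - \<xi>) * (1 - \<eta>) * (1 - q)))"
    unfolding weight_def using assms
    by (intro prod_mono conjI fac_nonneg fac_le) (auto simp: is_index_def intro: incr_tuples_nth_pos)
  then show ?thesis by simp
qed

lemma weight_snoc:
  "length ms = length k \<Longrightarrow> weight (k @ [b]) (ms @ [a]) = weight k ms * fac b a"
  by (auto simp: weight_def nth_append intro!: prod.cong)

lemma length_arrow_up: "k \<noteq> [] \<Longrightarrow> length (arrow_up k) = length k"
  by (simp add: arrow_up_def)

text \<open>Only the factor of the last entry changes, by \<open>fac_Suc\<close>. As
  \<open>k\<close> is non-empty, \<open>last (0 # ms)\<close> is a genuine positive entry.\<close>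

lemma weight_arrow_up:
  assumes "is_index k" "k \<noteq> []" and ms: "ms \<in> incr_tuples (length k)"
  shows "weight (arrow_up k) ms = weight k ms * (q ^ last (0 # ms) / num (last (0 # ms)))"
proof -
  obtain k' b where k: "k = k' @ [b]" using assms(2) by (metis append_butlast_last_id)
  have len: "length ms = length k' + 1" using ms k by (simp add: incr_tuples_def)
  then obtain ms' a where m: "ms = ms' @ [a]" by (cases ms rule: rev_cases) auto
  have "0 < b" using assms(1) k by (simp add: is_index_def)
  moreover have "0 < a" using last_incr_tuples_pos[OF ms] m k by simp
  moreover have "length ms' = length k'" using len m by simp
  ultimately show ?thesis
    by (simp add: k m arrow_up_def weight_snoc fac_Suc)
qed

lemma Z_sum_eq_Z_nn: "Z_sum q \<xi> \<eta> k l = enn2ereal (Z_nn k l)"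
proof -
  let ?f = "\<lambda>(ns, ms). weight l ns * conn (last (0 # ns)) (last (0 # ms)) * weight k ms"
  \<comment> \<open>Exchanging the indices first makes \<open>ns\<close> the outer coordinate,
    matching the order of integration in \<open>Z_nn\<close>.\<close>
  have "Z_sum q \<xi> \<eta> k l = Z_sum q \<xi> \<eta> l k"
    by (rule Z_sum_commute)
  also have "\<dots> = (\<Sum>\<^sub>\<infinity>z\<in>incr_tuples (length l) \<times> incr_tuples (length k). ereal (?f z))"
    by (simp add: Z_sum_def weight_def split_def)
  also have "\<dots> = enn2ereal (\<integral>\<^sup>+z. ennreal (?f z)
      \<partial>count_space (incr_tuples (length l) \<times> incr_tuples (length k)))"
    by (rule infsum_ereal_eq_nn_integral)
       (auto intro!: mult_nonneg_nonneg weight_nonneg conn_nonneg)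
  finally show ?thesis
    by (simp add: nn_integral_count_space_Sigma Z_nn_def mult_ac connector_commute)
qed

text \<open>This telescopes \<open>conn_step\<close>, multiplied by the weights \<open>w\<close> and
  \<open>w'\<close> of the fixed entries, over \<open>a > m\<close>. The boundary term is
  \<open>w * conn a n * w' * q^n / [n]\<close>; it vanishes in the limit because
  \<open>0 < n\<close>.\<close>

lemma transport_tail:
  assumes "0 < n" "0 \<le> w" "0 \<le> w'"
  shows "(\<integral>\<^sup>+a. ennreal (w * fac 1 a * conn a n * w') \<partial>count_space {m<..}) =
    ennreal (w * conn m n * (w' * (q ^ n / num n))) +
    ennreal (\<xi> * \<eta>) * (\<integral>\<^sup>+a. ennreal (w * fac 2 a * conn a n * (w' * (q ^ n / num n))) \<partial>count_space {m<..})"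
proof -
  define p where "p = q ^ n / num n"
  have p: "0 \<le> p" using q num_nonneg[of n] by (simp add: p_def)
  have fac: "0 \<le> fac b a" if "m < a" for a b using that by (intro fac_nonneg) simp
  have "(\<integral>\<^sup>+a. ennreal (w * fac 1 a * conn a n * w') \<partial>count_space {m<..}) =
      ennreal (w * conn m n * (w' * p)) +
      (\<integral>\<^sup>+a. ennreal (\<xi> * \<eta> * (w * fac 2 a * conn a n * (w' * p))) \<partial>count_space {m<..})"
  proof (rule nn_integral_telescope)
    show "(\<lambda>a. w * conn a n * (w' * p)) \<longlonglongrightarrow> 0"
      by (intro tendsto_mult_left_zero tendsto_mult_right_zero conn_tendsto_0 assms)
    show "w * fac 1 (Suc a) * conn (Suc a) n * w' + w * conn (Suc a) n * (w' * p) =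
        \<xi> * \<eta> * (w * fac 2 (Suc a) * conn (Suc a) n * (w' * p)) + w * conn a n * (w' * p)" for a
      using arg_cong[OF conn_step[OF assms(1), of a, folded p_def], of "\<lambda>x. w * w' * x"]
      by (simp add: distrib_left mult_ac)
  qed (use assms(2,3) p fac \<xi> \<eta> conn_nonneg in \<open>auto intro!: mult_nonneg_nonneg\<close>)
  also have "(\<integral>\<^sup>+a. ennreal (\<xi> * \<eta> * (w * fac 2 a * conn a n * (w' * p))) \<partial>count_space {m<..}) =
      (\<integral>\<^sup>+a. ennreal (\<xi> * \<eta>) * ennreal (w * fac 2 a * conn a n * (w' * p)) \<partial>count_space {m<..})"
    using assms(2,3) p fac \<xi> \<eta> conn_nonneg
    by (intro nn_integral_cong ennreal_mult mult_nonneg_nonneg) auto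
  finally show ?thesis
    by (simp add: nn_integral_cmult p_def)
qed

text \<open>For fixed \<open>ms\<close> and \<open>ns\<close>, \<open>transport_tail\<close> handles
  the extra last entry, and its factor \<open>q^n / [n]\<close> turns the weight of \<open>l\<close>
  into that of \<open>arrow_up l\<close>. Non-emptiness of \<open>l\<close> makes \<open>n\<close>
  positive.\<close>

lemma Z_nn_transport:
  assumes "is_index l" "l \<noteq> []"
  shows "Z_nn (k @ [1]) l = Z_nn k (arrow_up l) + ennreal (\<xi> * \<eta>) * Z_nn (k @ [2]) (arrow_up l)"
proof -
  let ?K = "count_space (incr_tuples (length k))" and ?L = "count_space (incr_tuples (length l))"
  let ?up = "arrow_up l"
  \<comment> \<open>Stated for every \<open>l'\<close> of the same length as \<open>l\<close>, so
    that it serves both \<open>l\<close> and \<open>arrow_up l\<close> over one outer space.\<close>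
  have split: "Z_nn (k @ [b]) l' = (\<integral>\<^sup>+ns. \<integral>\<^sup>+ms. \<integral>\<^sup>+a. ennreal (weight k ms * fac b a *
      conn a (last (0 # ns)) * weight l' ns) \<partial>count_space {last (0 # ms)<..} \<partial>?K \<partial>?L)"
    if "length l' = length l" for b l'
    unfolding Z_nn_def that
    by (simp add: nn_integral_incr_tuples_Suc)
       (intro nn_integral_cong, auto simp: incr_tuples_def weight_snoc)
  have "Z_nn (k @ [1]) l = (\<integral>\<^sup>+ns. \<integral>\<^sup>+ms.
      ennreal (weight k ms * conn (last (0 # ms)) (last (0 # ns)) * weight ?up ns) +
      ennreal (\<xi> * \<eta>) * (\<integral>\<^sup>+a. ennreal (weight k ms * fac 2 a *
        conn a (last (0 # ns)) * weight ?up ns) \<partial>count_space {last (0 # ms)<..}) \<partial>?K \<partial>?L)"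
    unfolding split[OF refl]
  proof (intro nn_integral_cong)
    fix ns ms assume "ns \<in> space ?L" "ms \<in> space ?K"
    then have ns: "ns \<in> incr_tuples (length l)" and ms: "ms \<in> incr_tuples (length k)" by auto
    then have "0 < last (0 # ns)" using assms(2) by (intro last_incr_tuples_pos) auto
    from transport_tail[OF this weight_nonneg[OF ms] weight_nonneg[OF ns]]
    show "(\<integral>\<^sup>+a. ennreal (weight k ms * fac 1 a * conn a (last (0 # ns)) * weight l ns)
        \<partial>count_space {last (0 # ms)<..}) =
      ennreal (weight k ms * conn (last (0 # ms)) (last (0 # ns)) * weight ?up ns) +
      ennreal (\<xi> * \<eta>) * (\<integral>\<^sup>+a. ennreal (weight k ms * fac 2 a *
        conn a (last (0 # ns)) * weight ?up ns) \<partial>count_space {last (0 # ms)<..})"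
      unfolding weight_arrow_up[OF assms ns] .
  qed
  also have "\<dots> = Z_nn k ?up + ennreal (\<xi> * \<eta>) * Z_nn (k @ [2]) ?up"
    using length_arrow_up[OF assms(2)]
    by (simp add: split nn_integral_add nn_integral_cmult Z_nn_def[of k ?up])
  finally show ?thesis .
qed

section \<open>Finiteness of the subtracted series\<close>

text \<open>Summing \<open>q^a\<close> over \<open>a > m\<close> gives a constant times
  \<open>q^m\<close>, so the same integrand reappears for tuples one entry shorter.\<close>

lemma nn_integral_incr_tuples_power_finite:
  "(\<integral>\<^sup>+ms. ennreal (q ^ last (0 # ms)) \<partial>count_space (incr_tuples r)) < \<infinity>"
proof (induction r)
  case 0
  have "incr_tuples 0 = {[]}" by (auto simp: incr_tuples_def)
  then show ?case by (simp add: nn_integral_count_space_finite)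
next
  case (Suc r)
  have "(\<integral>\<^sup>+a. ennreal (q ^ a) \<partial>count_space {m<..}) = ennreal (q / (1 - q)) * ennreal (q ^ m)" for m
  proof -
    \<comment> \<open>The geometric tail is itself a telescoping sum, with \<open>V = 0\<close> and
      \<open>D a\<close> equal to the tail beyond \<open>a\<close>.\<close>
    have "(\<integral>\<^sup>+a. ennreal (q ^ a) \<partial>count_space {m<..}) =
        ennreal (q / (1 - q) * q ^ m) + (\<integral>\<^sup>+a. ennreal 0 \<partial>count_space {m<..})"
    proof (rule nn_integral_telescope)
      show "(\<lambda>a. q / (1 - q) * q ^ a) \<longlonglongrightarrow> 0"
        using q by (intro tendsto_mult_right_zero LIMSEQ_power_zero) simp
    qed (use q in \<open>auto simp: field_simps\<close>)
    then show ?thesis using q by (simp add: ennreal_mult'[symmetric])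
  qed
  with Suc show ?case
    by (simp add: nn_integral_incr_tuples_Suc nn_integral_cmult ennreal_mult_less_top)
qed

text \<open>Both last entries are at least 2 and contribute \<open>q^M\<close> and
  \<open>q^N\<close>, with \<open>M\<close> and \<open>N\<close> the last tuple entries. The
  connector is at most \<open>K\<close>, and each remaining factor at most \<open>C\<close>; the
  bound then splits into two finite integrals.\<close>

lemma Z_nn_arrow_up_finite:
  assumes k: "is_index k" "k \<noteq> []" and l: "is_index l" "l \<noteq> []"
  shows "Z_nn (arrow_up k) (arrow_up l) < \<infinity>"
proof -
  define C where "C = 1 / ((1 - \<xi>) * (1 - \<eta>) * (1 - q))"
  define K where "K = 1 / ((1 - \<delta>) * (1 - q))"
  have C: "0 \<le> C" and K: "0 \<le> K"
    using q \<xi> \<eta> \<delta>_less_1 by (simp_all add: C_def K_def)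
  have up: "weight (arrow_up k) ms \<le> C ^ length k * q ^ last (0 # ms)"
    if "is_index k" "k \<noteq> []" "ms \<in> incr_tuples (length k)" for k ms
  proof -
    have "1 \<le> num (last (0 # ms))"
      using that by (intro num_ge_1 last_incr_tuples_pos) auto
    then have "q ^ last (0 # ms) / num (last (0 # ms)) \<le> q ^ last (0 # ms)"
      using q by (simp add: divide_le_eq mult_le_cancel_left1)
    then show ?thesis
      unfolding weight_arrow_up[OF that] C_def
      using q weight_le[OF that(1,3)] C num_nonneg
      by (intro mult_mono) (auto simp: C_def)
  qed
  let ?T = "\<lambda>r. count_space (incr_tuples r)"
  have "Z_nn (arrow_up k) (arrow_up l) \<le>
      (\<integral>\<^sup>+ns. \<integral>\<^sup>+ms. ennreal (C ^ length k * K * C ^ length l) *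
        ennreal (q ^ last (0 # ns)) * ennreal (q ^ last (0 # ms)) \<partial>?T (length k) \<partial>?T (length l))"
    unfolding Z_nn_def length_arrow_up[OF k(2)] length_arrow_up[OF l(2)]
  proof (intro nn_integral_mono)
    fix ns ms assume "ns \<in> space (?T (length l))" "ms \<in> space (?T (length k))"
    then have ns: "ns \<in> incr_tuples (length l)" and ms: "ms \<in> incr_tuples (length k)" by auto
    define M N where "M = last (0 # ms)" and "N = last (0 # ns)"
    have "conn M N \<le> q ^ (M * N) * K"
      using conn_le[of M N] by (simp add: K_def)
    also have "\<dots> \<le> K"
      using q K by (intro mult_left_le_one_le power_le_one) auto
    finally have "weight (arrow_up k) ms * conn M N * weight (arrow_up l) ns \<le>
        (C ^ length k * q ^ M) * K * (C ^ length l * q ^ N)"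
      using up[OF k ms] up[OF l ns] C K q conn_nonneg[of M N]
        weight_nonneg[of ms "arrow_up k"] weight_nonneg[of ns "arrow_up l"] ms ns
        length_arrow_up[OF k(2)] length_arrow_up[OF l(2)]
      unfolding M_def N_def by (intro mult_mono mult_nonneg_nonneg) auto
    also have "\<dots> = C ^ length k * K * C ^ length l * q ^ N * q ^ M"
      by simp
    finally show "ennreal (weight (arrow_up k) ms * conn (last (0 # ms)) (last (0 # ns)) *
        weight (arrow_up l) ns) \<le> ennreal (C ^ length k * K * C ^ length l) *
        ennreal (q ^ last (0 # ns)) * ennreal (q ^ last (0 # ms))"
      using C K q by (simp add: M_def N_def ennreal_mult'[symmetric] ennreal_leI)
  qed
  also have "\<dots> < \<infinity>"
    using nn_integral_incr_tuples_power_finite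
    by (simp add: nn_integral_cmult nn_integral_multc ennreal_mult_less_top)
  finally show ?thesis .
qed

section \<open>The two relations in the extended reals\<close>

lemma Z_sum_arrow_right:
  assumes "is_index l" "l \<noteq> []"
  shows "Z_sum q \<xi> \<eta> (arrow_right k) l = Z_sum q \<xi> \<eta> k (arrow_up l)
    + ereal (\<xi> * \<eta>) * Z_sum q \<xi> \<eta> (arrow_up (arrow_right k)) (arrow_up l)"
  unfolding Z_sum_eq_Z_nn arrow_up_arrow_right unfolding arrow_right_def Z_nn_transport[OF assms]
  using \<xi> \<eta> by (simp add: plus_ennreal.rep_eq times_ennreal.rep_eq)

lemma Z_sum_arrow_up_finite:
  assumes "is_index k" "k \<noteq> []" "is_index l" "l \<noteq> []"
  shows "Z_sum q \<xi> \<eta> (arrow_up k) (arrow_up l) < \<infinity>"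
  using Z_nn_arrow_up_finite[OF assms]
  by (simp add: Z_sum_eq_Z_nn less_ennreal.rep_eq)

lemma Z_sum_arrow_up:
  assumes "is_index k" "k \<noteq> []" "is_index l"
  shows "Z_sum q \<xi> \<eta> (arrow_up k) l = Z_sum q \<xi> \<eta> k (arrow_right l)
    - ereal (\<xi> * \<eta>) * Z_sum q \<xi> \<eta> (arrow_up k) (arrow_up (arrow_right l))"
proof -
  let ?c = "ereal (\<xi> * \<eta>) * Z_sum q \<xi> \<eta> (arrow_up k) (arrow_up (arrow_right l))"
  \<comment> \<open>In \<open>ereal\<close>, adding and then subtracting \<open>?c\<close> restores
    every value only if \<open>?c\<close> is finite.\<close>
  have "Z_sum q \<xi> \<eta> (arrow_up k) (arrow_up (arrow_right l)) < \<infinity>"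
    using assms by (intro Z_sum_arrow_up_finite) (auto simp: arrow_right_def is_index_def)
  moreover have "0 \<le> Z_sum q \<xi> \<eta> (arrow_up k) (arrow_up (arrow_right l))"
    by (simp add: Z_sum_eq_Z_nn)
  ultimately have "\<bar>?c\<bar> \<noteq> \<infinity>"
    by (cases "Z_sum q \<xi> \<eta> (arrow_up k) (arrow_up (arrow_right l))") auto
  \<comment> \<open>This is the first relation with the roles of \<open>k\<close> and
    \<open>l\<close> exchanged, read back through the symmetry of the connected sum.\<close>
  moreover have "Z_sum q \<xi> \<eta> k (arrow_right l) = Z_sum q \<xi> \<eta> (arrow_up k) l + ?c"
    using Z_sum_arrow_right[OF assms(1,2), of l]
    by (simp only: Z_sum_commute[of _ _ _ k] Z_sum_commute[of _ _ _ "arrow_up k"])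
  ultimately show ?thesis
    by (cases ?c; cases "Z_sum q \<xi> \<eta> (arrow_up k) l") auto
qed

end

text \<open>The finiteness conjunct certifies that the difference is never of the form \<infinity> -
  \<infinity>, to which \<open>ereal\<close> also assigns a value.\<close>

theorem theorem2p4:
  fixes q :: real
  assumes "0 < q" and "q < 1"
  shows "\<exists>\<epsilon>>0. \<forall>\<xi> \<eta> :: real. 0 \<le> \<xi> \<and> \<xi> < \<epsilon> \<and> 0 \<le> \<eta> \<and> \<eta> < \<epsilon> \<longrightarrow>
    (\<forall>k l. is_index k \<and> is_index l \<longrightarrow>
      (l \<noteq> [] \<longrightarrow>
         Z_sum q \<xi> \<eta> (arrow_right k) l =
           Z_sum q \<xi> \<eta> k (arrow_up l)
           + ereal (\<xi> * \<eta>) * Z_sum q \<xi> \<eta> (arrow_up (arrow_right k)) (arrow_up l)) \<and>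
      (k \<noteq> [] \<longrightarrow>
         Z_sum q \<xi> \<eta> (arrow_up k) (arrow_up (arrow_right l)) < \<infinity> \<and>
         Z_sum q \<xi> \<eta> (arrow_up k) l =
           Z_sum q \<xi> \<eta> k (arrow_right l)
           - ereal (\<xi> * \<eta>) * Z_sum q \<xi> \<eta> (arrow_up k) (arrow_up (arrow_right l))))"
proof -
  \<comment> \<open>With \<xi> and \<eta> below 1/4, the parameter \<delta> stays below 1/4 + 1/4 +
    1/16 = 9/16.\<close>
  have params: "connected_sum q \<xi> \<eta>"
    if "0 \<le> \<xi>" "\<xi> < 1 / 4" "0 \<le> \<eta>" "\<eta> < 1 / 4" for \<xi> \<eta>
  proof
    have "(1 - q) * \<xi> * \<eta> \<le> 1 * (1 / 4) * (1 / 4)"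
      using assms that by (intro mult_mono) auto
    then show "\<xi> + \<eta> + (1 - q) * \<xi> * \<eta> < 1" using that by simp
  qed (use assms that in auto)
  have index: "is_index (arrow_right l)" "arrow_right l \<noteq> []" if "is_index l" for l
    using that by (auto simp: arrow_right_def is_index_def)
  show ?thesis
  proof (intro exI[of _ "1 / 4"] conjI allI impI; (elim conjE)?)
    fix \<xi> \<eta> :: real and k l :: "nat list"
    assume "0 \<le> \<xi>" "\<xi> < 1 / 4" "0 \<le> \<eta>" "\<eta> < 1 / 4"
    then interpret connected_sum q \<xi> \<eta> by (rule params)
    assume k: "is_index k" and l: "is_index l"
    show "Z_sum q \<xi> \<eta> (arrow_right k) l = Z_sum q \<xi> \<eta> k (arrow_up l)
        + ereal (\<xi> * \<eta>) * Z_sum q \<xi> \<eta> (arrow_up (arrow_right k)) (arrow_up l)" if "l \<noteq> []"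
      using l that by (rule Z_sum_arrow_right)
    show "Z_sum q \<xi> \<eta> (arrow_up k) (arrow_up (arrow_right l)) < \<infinity>" if "k \<noteq> []"
      using k that index[OF l] by (rule Z_sum_arrow_up_finite)
    show "Z_sum q \<xi> \<eta> (arrow_up k) l = Z_sum q \<xi> \<eta> k (arrow_right l)
        - ereal (\<xi> * \<eta>) * Z_sum q \<xi> \<eta> (arrow_up k) (arrow_up (arrow_right l))" if "k \<noteq> []"
      using k that l by (rule Z_sum_arrow_up)
  qed simp
qed

end
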